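(* Let $n>m\ge 1$, let $A$ be a real $(m\times n)$-matrix of full rank, let $\kappa$ be the condition number of $A$, and let $0\le\delta<1$. For $R>0$ put $$V_R=\frac{\lambda\big(\{x\in\mathbb{R}^n\mid \|Ax\|<\delta\,\|A\|\,\|x\|,\ \|x\|\le R\}\big)}{\lambda\big(\{x\in\mathbb{R}^n\mid\|x\|\le R\}\big)} .$$ (i) If $\kappa\delta<1$, then for all radii $R>0$ $$V_R\le\psi\bigg(\frac{\kappa\delta}{\sqrt{1-\kappa^2\delta^2}}\bigg).$$ (ii) Without further conditions on $\delta<1$, for all radii $R>0$ $$V_R\ge\psi\bigg(\frac{\delta}{\sqrt{1-\delta^2}}\bigg).$$ (iii) For orthogonal projections, that is, if $\kappa=1$, equality holds in both (i) and (ii).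
   Context: $\|x\|$ and $\|Ax\|$ are Euclidean norms, $\|A\|$ is the spectral norm, and $\lambda$ is the volume (Lebesgue) measure on $\mathbb{R}^n$. The condition number $\kappa$ is the ratio of the maximum to the minimum of the $m$ singular values of $A$. The function $\psi$ (depending on $m$ and $n$) is defined for $\varepsilon\ge0$ by $$\psi(\varepsilon)=\frac{2\,\Gamma(n/2)}{\Gamma(m/2)\,\Gamma((n-m)/2)}\int_0^{\varepsilon}\frac{t^{m-1}}{(1+t^2)^{n/2}}\,dt .$$ *)

theory Defs
  imports "HOL-Analysis.Analysis"
begin

(* The singular values of an m x n matrix with m \<le> n, as a set (i.e. without multiplicities):
   the nonnegative square roots of the m eigenvalues of the m x m matrix A A^T.
   For m > n the set would always contain 0, unlike the usual convention. *)
definition singular_values :: "real^'n^'m \<Rightarrow> real set" where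
  "singular_values A =
     {\<sigma>. 0 \<le> \<sigma> \<and> (\<exists>v. v \<noteq> 0 \<and> (A ** transpose A) *v v = \<sigma>\<^sup>2 *\<^sub>R v)}"

definition cond_num :: "real^'n^'m \<Rightarrow> real" where
  "cond_num A = Max (singular_values A) / Min (singular_values A)"

(* The norm of the type real^'n^'m is the Frobenius norm, so the spectral norm is
   expressed as the operator norm of the induced map between Euclidean spaces. *)
definition spectral_norm :: "real^'n^'m \<Rightarrow> real" where
  "spectral_norm A = onorm (\<lambda>x. A *v x)"

definition psi :: "nat \<Rightarrow> nat \<Rightarrow> real \<Rightarrow> real" where
  "psi m n \<epsilon> =
     2 * Gamma (real n / 2) / (Gamma (real m / 2) * Gamma ((real n - real m) / 2)) *
       integral {0..\<epsilon>} (\<lambda>t. t ^ (m - 1) / (1 + t\<^sup>2) powr (real n / 2))"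

definition vol_ratio :: "real^'n^'m \<Rightarrow> real \<Rightarrow> real \<Rightarrow> real" where
  "vol_ratio A \<delta> R =
     measure lebesgue {x. norm (A *v x) < \<delta> * spectral_norm A * norm x \<and> norm x \<le> R} /
     measure lebesgue {x :: real^'n. norm x \<le> R}"

end

theory Submission
  imports Defs
begin

text \<open>
  Let \<open>P\<close> be the orthogonal projection onto the row space of \<open>A\<close>, the orthogonal complement of its
  kernel. Then \<open>A *v x = A *v P x\<close>, and on the row space \<open>A\<close> stretches lengths by factors between the
  smallest singular value \<open>\<tau>\<close> and the largest one \<open>\<sigma>\<close>, which is also the spectral norm
  (\<open>orthonormal_row_space_basis\<close>, \<open>spectral_norm_eq_Max_singular_value\<close>). The set of all \<open>x\<close> with
  \<open>norm (A *v x) < \<delta> * \<sigma> * norm x\<close> therefore contains the cone \<open>norm (P x) < \<delta> * norm x\<close>, and it is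
  contained in the cone \<open>norm (P x) < \<delta> * (\<sigma> / \<tau>) * norm x\<close>. Both are cones around the kernel of
  \<open>A\<close>, and the theorem follows from the exact volume of such a cone (\<open>measure_orthonormal_cone_ratio\<close>); for
  condition number one the two cones coincide.

  To find that volume, a rotation moves the row space to a coordinate subspace, where the cone reads
  \<open>r < \<epsilon> * s\<close> with \<open>r\<close> and \<open>s\<close> the lengths of the two components of a vector. Fubini and polar
  coordinates in each of the two blocks of coordinates leave a planar integral, and the substitution
  \<open>r = s * t\<close> separates it into a power of the radius \<open>R\<close> and the integral in \<open>psi\<close>
  (\<open>nn_integral_planar_sector\<close>, \<open>emeasure_coordinate_cone\<close>).

  The facts about singular values rest on a variational argument: the extreme values of the
  quadratic form of a self-adjoint map on the unit sphere are attained, and they are eigenvalues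
  (\<open>self_adjoint_max_eigenvalue\<close>).
\<close>

section \<open>Rotation invariance of Lebesgue measure\<close>

text \<open>
  Translation invariance determines Lebesgue measure up to a factor, and an orthogonal map
  preserves the unit ball, which fixes the factor as one. The usual uniqueness argument for
  translation invariant measures applies directly: with \<open>B\<close> the unit ball, the double integral of
  \<open>indicator E (T x) * indicator B (y + T x)\<close> over \<open>x\<close> and \<open>y\<close> equals the measure of \<open>T -` E\<close>
  times the volume of \<open>B\<close> when \<open>y\<close> is integrated first, and the measure of \<open>E\<close> times
  the volume of \<open>B\<close> when \<open>T x\<close> is first shifted by \<open>-y\<close>.
\<close>

lemma lborel_distr_orthogonal_transformation:
  fixes T :: "'a::euclidean_space \<Rightarrow> 'a"
  assumes T: "orthogonal_transformation T"
  shows "distr lborel borel T = lborel"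
proof (rule measure_eqI)
  have lin: "linear T" using T by (rule orthogonal_transformation_linear)
  then have [measurable]: "T \<in> borel_measurable borel"
    by (intro borel_measurable_continuous_onI linear_continuous_on)
      (simp add: linear_conv_bounded_linear)
  have translate: "(\<integral>\<^sup>+x. f (x + c) \<partial>lborel) = (\<integral>\<^sup>+x. f x \<partial>lborel)"
    if [measurable]: "f \<in> borel_measurable borel" for f and c :: 'a
    by (subst (2) lborel_distr_plus[of c, symmetric]) (simp add: nn_integral_distr add.commute)
  have reflect: "(\<integral>\<^sup>+x. f (- x) \<partial>lborel) = (\<integral>\<^sup>+x. f x \<partial>lborel)"
    if [measurable]: "f \<in> borel_measurable borel" for f :: "'a \<Rightarrow> ennreal"
    by (subst (2) lborel_affine[of "-1" 0]) (simp_all add: nn_integral_density nn_integral_distr)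
  let ?B = "cball 0 1 :: 'a set"
  have [measurable]: "?B \<in> sets borel" by simp
  let ?v = "emeasure lborel ?B"
  fix E :: "'a set" assume "E \<in> sets (distr lborel borel T)"
  then have [measurable]: "E \<in> sets borel" by simp
  have B: "indicator ?B (T x) = (indicator ?B x :: ennreal)" for x
    using T by (simp add: indicator_def orthogonal_transformation_norm)
  \<comment> \<open>The chain starts and ends with a factor \<open>?v\<close>, which is finite and nonzero and cancels.\<close>
  have "?v * emeasure (distr lborel borel T) E = ?v * (\<integral>\<^sup>+x. indicator E (T x) \<partial>lborel)"
    by (simp flip: nn_integral_indicator add: nn_integral_distr)
  also have "\<dots> = (\<integral>\<^sup>+x. indicator E (T x) * ?v \<partial>lborel)"
    by (subst nn_integral_multc) (simp_all add: mult.commute)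
  also have "\<dots> = (\<integral>\<^sup>+x. indicator E (T x) * (\<integral>\<^sup>+y. indicator ?B (y + T x) \<partial>lborel) \<partial>lborel)"
    by (subst translate) (simp_all add: borel_measurable_indicator)
  also have "\<dots> = (\<integral>\<^sup>+x. (\<integral>\<^sup>+y. indicator E (T x) * indicator ?B (y + T x) \<partial>lborel) \<partial>lborel)"
    by (simp add: nn_integral_cmult)
  also have "\<dots> = (\<integral>\<^sup>+y. (\<integral>\<^sup>+x. indicator E (T x) * indicator ?B (y + T x) \<partial>lborel) \<partial>lborel)"
    by (rule lborel_pair.Fubini'[symmetric]) measurable
  \<comment> \<open>The shift by \<open>y\<close> after \<open>T\<close> is a shift by a preimage of \<open>y\<close> before \<open>T\<close>.\<close>
  also have "\<dots> = (\<integral>\<^sup>+y. (\<integral>\<^sup>+x. indicator E (T x - y) * indicator ?B (T x) \<partial>lborel) \<partial>lborel)"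
  proof (rule nn_integral_cong)
    fix y
    obtain z where z: "y = T z"
      using orthogonal_transformation_surj[OF T] by (auto simp: surj_def)
    show "(\<integral>\<^sup>+x. indicator E (T x) * indicator ?B (y + T x) \<partial>lborel) =
        (\<integral>\<^sup>+x. indicator E (T x - y) * indicator ?B (T x) \<partial>lborel)"
      by (subst translate[of _ "- z", symmetric]) (simp_all add: z linear_diff[OF lin])
  qed
  also have "\<dots> = (\<integral>\<^sup>+x. (\<integral>\<^sup>+y. indicator E (T x - y) * indicator ?B (T x) \<partial>lborel) \<partial>lborel)"
    by (rule lborel_pair.Fubini') measurable
  also have "\<dots> = (\<integral>\<^sup>+x. (\<integral>\<^sup>+y. indicator E (T x - y) \<partial>lborel) * indicator ?B x \<partial>lborel)"
    by (simp add: nn_integral_multc B)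
  also have "\<dots> = (\<integral>\<^sup>+x. emeasure lborel E * indicator ?B x \<partial>lborel)"
  proof (intro nn_integral_cong arg_cong2[where f = "(*)"] refl)
    fix x
    have "(\<integral>\<^sup>+y. indicator E (T x - y) \<partial>lborel) = (\<integral>\<^sup>+y. indicator E (y + T x) \<partial>lborel)"
      by (subst reflect[symmetric]) (simp_all add: add.commute)
    then show "(\<integral>\<^sup>+y. indicator E (T x - y) \<partial>lborel) = emeasure lborel E"
      by (subst (asm) translate) simp_all
  qed
  also have "\<dots> = ?v * emeasure lborel E"
    by (simp add: nn_integral_cmult mult.commute)
  finally show "emeasure (distr lborel borel T) E = emeasure lborel E"
    using unit_ball_vol_pos[of "DIM('a)"] by (simp add: emeasure_cball ennreal_mult_cancel_left del: unit_ball_vol_pos)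
qed simp

section \<open>Radial integration in coordinate blocks\<close>

text \<open>
  Integration in polar coordinates, for radial functions only. The two measures agree on the
  half-lines \<open>{..r}\<close> because the derivative of the volume \<open>unit_ball_vol k * r ^ k\<close> of the ball
  is the density. Finite products indexed by a set \<open>K\<close> replace Euclidean types here because the
  two blocks of coordinates of a decomposition do not correspond to types.
\<close>

lemma distr_norm_PiM_lborel:
  assumes fin: "finite K" and ne: "K \<noteq> {}"
  shows "distr (\<Pi>\<^sub>M i\<in>K. lborel) borel (\<lambda>x. sqrt (\<Sum>i\<in>K. (x i)\<^sup>2)) =
    density lborel (\<lambda>r. ennreal (card K * unit_ball_vol (card K) * r ^ (card K - 1)) * indicator {0..} r)"
    (is "distr ?P borel ?N = density lborel ?g")
proof -
  interpret product_sigma_finite "\<lambda>_. lborel" by standard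
  let ?k = "card K" and ?c = "card K * unit_ball_vol (card K)"
  have k: "?k > 0" using fin ne by (simp add: card_gt_0_iff)
  have [measurable]: "?N \<in> borel_measurable ?P" using fin by measurable
  have eq: "emeasure (distr ?P borel ?N) {..r} = emeasure (density lborel ?g) {..r}"
    and fin: "emeasure (distr ?P borel ?N) {..r} \<noteq> \<infinity>" for r
  proof -
    have L: "emeasure (distr ?P borel ?N) {..r} = emeasure ?P ({f. ?N f \<le> r} \<inter> space ?P)"
      by (subst emeasure_distr) (auto simp: vimage_def)
    have R: "emeasure (density lborel ?g) {..r} = (\<integral>\<^sup>+x. ennreal (?c * x ^ (?k - 1)) * indicator {0..r} x \<partial>lborel)"
      by (subst emeasure_density) (auto intro!: nn_integral_cong simp: indicator_def)
    have R': "emeasure (density lborel ?g) {..r} = ennreal (unit_ball_vol ?k * r ^ ?k)" if "0 \<le> r"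
    proof -
      have "((\<lambda>x. unit_ball_vol ?k * x ^ ?k) has_real_derivative ?c * x ^ (?k - 1)) (at x)" for x
        by (auto intro!: derivative_eq_intros)
      then have "(\<integral>\<^sup>+x. ennreal (?c * x ^ (?k - 1)) * indicator {0..r} x \<partial>lborel)
          = unit_ball_vol ?k * r ^ ?k - unit_ball_vol ?k * 0 ^ ?k"
        using that by (intro nn_integral_FTC_Icc) auto
      then show ?thesis using k unfolding R by (simp add: zero_power)
    qed
    have "emeasure (distr ?P borel ?N) {..r} = emeasure (density lborel ?g) {..r} \<and>
      emeasure (distr ?P borel ?N) {..r} \<noteq> \<infinity>"
    \<comment> \<open>For \<open>r = 0\<close> only the origin remains, which is a null set as \<open>K\<close> is nonempty.\<close>
    proof (cases r "0::real" rule: linorder_cases)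
      case less
      have "{f. ?N f \<le> r} = {}" using less
        by (auto simp: not_le intro!: less_le_trans[OF less] sum_nonneg)
      then show ?thesis using less unfolding L R by simp
    next
      case equal
      have "?N f \<le> r \<longleftrightarrow> (\<forall>i\<in>K. f i = 0)" for f
        using equal sum_nonneg_eq_0_iff[OF \<open>finite K\<close>, of "\<lambda>i. (f i)\<^sup>2"] sum_nonneg[of K "\<lambda>i. (f i)\<^sup>2"]
        by (simp add: antisym_conv)
      then have "{f. ?N f \<le> r} \<inter> space ?P = Pi\<^sub>E K (\<lambda>_. {0})"
        by (auto simp: space_PiM PiE_iff extensional_def)
      then have "emeasure (distr ?P borel ?N) {..r} = (\<Prod>i\<in>K. emeasure lborel {0::real})"
        unfolding L using \<open>finite K\<close> by (simp only: emeasure_PiM sets_lborel borel_singleton sets.empty_sets)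
      then show ?thesis using equal R' k by (simp add: zero_power)
    next
      case greater
      then show ?thesis using R' emeasure_cball_aux[OF \<open>finite K\<close>, of r] by (simp add: L)
    qed
    then show "emeasure (distr ?P borel ?N) {..r} = emeasure (density lborel ?g) {..r}"
      "emeasure (distr ?P borel ?N) {..r} \<noteq> \<infinity>" by auto
  qed
  show ?thesis
  proof (rule measure_eqI_generator_eq[of "range atMost" UNIV _ _ "\<lambda>n. {..real n}"])
    show "Int_stable (range (atMost :: real \<Rightarrow> _))"
      by (auto simp: Int_stable_def)
    show "(\<Union>i. {..real i}) = UNIV" by (auto intro: real_arch_simple)
    show "sets (distr ?P borel ?N) = sigma_sets UNIV (range atMost)"
      by (simp add: borel_eq_atMost)
    show "sets (density lborel ?g) = sigma_sets UNIV (range atMost)"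
      by (simp add: borel_eq_atMost)
  qed (use eq fin in auto)
qed

lemma nn_integral_radial_PiM_lborel:
  assumes "finite K" "K \<noteq> {}" and [measurable]: "f \<in> borel_measurable borel"
  shows "(\<integral>\<^sup>+x. f (sqrt (\<Sum>i\<in>K. (x i)\<^sup>2)) \<partial>(\<Pi>\<^sub>M i\<in>K. lborel)) =
    (\<integral>\<^sup>+r. ennreal (card K * unit_ball_vol (card K) * r ^ (card K - 1)) * indicator {0..} r * f r \<partial>lborel)"
proof -
  have [measurable]: "(\<lambda>x. sqrt (\<Sum>i\<in>K. (x i)\<^sup>2)) \<in> borel_measurable (\<Pi>\<^sub>M i\<in>K. lborel)"
    using assms by measurable
  show ?thesis
    using nn_integral_distr[of "\<lambda>x. sqrt (\<Sum>i\<in>K. (x i)\<^sup>2)" "\<Pi>\<^sub>M i\<in>K. lborel" borel f]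
    by (simp add: distr_norm_PiM_lborel assms nn_integral_density)
qed

section \<open>The volume of a cone around a coordinate subspace\<close>

lemma nn_integral_power_Icc:
  assumes "0 < n" "0 \<le> r"
  shows "(\<integral>\<^sup>+s. ennreal (s ^ (n - 1)) * indicator {0..r} s \<partial>lborel) = ennreal (r ^ n / n)"
proof -
  have "((\<lambda>s. s ^ n / n) has_real_derivative s ^ (n - 1)) (at s)" for s
    using assms by (auto intro!: derivative_eq_intros)
  then have "(\<integral>\<^sup>+s. ennreal (s ^ (n - 1)) * indicator {0..r} s \<partial>lborel) = r ^ n / n - 0 ^ n / n"
    using assms by (intro nn_integral_FTC_Icc) auto
  then show ?thesis using assms by (simp add: zero_power)
qed

text \<open>
  This is the volume of the cone within the ball after both blocks of coordinates have been replaced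
  by their radii \<open>r\<close> and \<open>s\<close>, up to constant factors. The substitution \<open>r = s * t\<close> turns the
  condition \<open>r < \<epsilon> * s\<close> into \<open>t < \<epsilon>\<close> and the ball condition into \<open>s \<le> R / sqrt (1 + t\<^sup>2)\<close>,
  so that the integral over \<open>s\<close> is elementary and leaves the integrand of \<open>psi\<close>.
\<close>

lemma nn_integral_planar_sector:
  fixes \<epsilon> R :: real
  assumes p: "0 < p" and q: "0 < q" and \<epsilon>: "0 \<le> \<epsilon>" and R: "0 \<le> R"
  shows "(\<integral>\<^sup>+s. (\<integral>\<^sup>+r. (if 0 \<le> s \<and> 0 \<le> r \<and> r < \<epsilon> * s \<and> r\<^sup>2 + s\<^sup>2 \<le> R\<^sup>2
              then ennreal (r ^ (p - 1) * s ^ (q - 1)) else 0) \<partial>lborel) \<partial>lborel) =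
    ennreal (R ^ (p + q) / real (p + q) *
      integral {0..\<epsilon>} (\<lambda>t. t ^ (p - 1) / (1 + t\<^sup>2) powr (real (p + q) / 2)))"
    (is "(\<integral>\<^sup>+s. (\<integral>\<^sup>+r. ?G s r \<partial>lborel) \<partial>lborel) = _")
proof -
  let ?H = "\<lambda>s t. if 0 \<le> s \<and> 0 \<le> t \<and> t < \<epsilon> \<and> s * sqrt (1 + t\<^sup>2) \<le> R
              then ennreal (t ^ (p - 1) * s ^ (p + q - 1)) else 0"
  let ?h = "\<lambda>t. t ^ (p - 1) / (1 + t\<^sup>2) powr (real (p + q) / 2)"
  have pow: "s * ((s * t) ^ (p - 1) * s ^ (q - 1)) = t ^ (p - 1) * s ^ (p + q - 1)" for s t :: real
  proof -
    obtain p' q' where "p = Suc p'" "q = Suc q'" using p q gr0_implies_Suc by blast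
    then show ?thesis by (simp add: power_mult_distrib power_add mult_ac)
  qed
  have "(\<integral>\<^sup>+s. (\<integral>\<^sup>+r. ?G s r \<partial>lborel) \<partial>lborel) = (\<integral>\<^sup>+s. (\<integral>\<^sup>+t. ?H s t \<partial>lborel) \<partial>lborel)"
  proof (rule nn_integral_cong)
    fix s :: real
    show "(\<integral>\<^sup>+r. ?G s r \<partial>lborel) = (\<integral>\<^sup>+t. ?H s t \<partial>lborel)"
    proof (cases "0 < s")
      case True
      have [measurable]: "?G s \<in> borel_measurable borel" by measurable
      have "(\<integral>\<^sup>+r. ?G s r \<partial>lborel) = ennreal s * (\<integral>\<^sup>+t. ?G s (0 + s * t) \<partial>lborel)"
        using True nn_integral_real_affine[of "?G s" s 0] by simp
      also have "\<dots> = (\<integral>\<^sup>+t. ennreal s * ?G s (0 + s * t) \<partial>lborel)"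
        by (rule nn_integral_cmult[symmetric]) measurable
      also have "\<dots> = (\<integral>\<^sup>+t. ?H s t \<partial>lborel)"
      proof (rule nn_integral_cong)
        fix t
        have "(s * t)\<^sup>2 + s\<^sup>2 = (s * sqrt (1 + t\<^sup>2))\<^sup>2"
          by (simp add: power_mult_distrib algebra_simps add_nonneg_nonneg)
        then have "(s * t)\<^sup>2 + s\<^sup>2 \<le> R\<^sup>2 \<longleftrightarrow> s * sqrt (1 + t\<^sup>2) \<le> R"
          using True R by (simp add: power2_le_iff_abs_le)
        moreover have "0 \<le> s * t \<longleftrightarrow> 0 \<le> t" "s * t < \<epsilon> * s \<longleftrightarrow> t < \<epsilon>"
          using True by (simp_all add: zero_le_mult_iff mult.commute)
        ultimately show "ennreal s * ?G s (0 + s * t) = ?H s t"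
          using True pow[of s t] by (simp flip: ennreal_mult')
      qed
      finally show ?thesis .
    next
      case False
      then have "?G s r = 0" "?H s t = 0" for r t
        using p q by (auto simp: not_less zero_power)
      then show ?thesis by simp
    qed
  qed
  also have "\<dots> = (\<integral>\<^sup>+t. (\<integral>\<^sup>+s. ?H s t \<partial>lborel) \<partial>lborel)"
    by (rule lborel_pair.Fubini') measurable
  also have "\<dots> = (\<integral>\<^sup>+t. ennreal (R ^ (p + q) / real (p + q) * ?h t) * indicator {0..<\<epsilon>} t \<partial>lborel)"
  proof (rule nn_integral_cong)
    fix t :: real
    show "(\<integral>\<^sup>+s. ?H s t \<partial>lborel) = ennreal (R ^ (p + q) / real (p + q) * ?h t) * indicator {0..<\<epsilon>} t"
    proof (cases "t \<in> {0..<\<epsilon>}")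
      case True
      have pos: "0 < sqrt (1 + t\<^sup>2)" by (simp add: add_pos_nonneg)
      have "(\<integral>\<^sup>+s. ?H s t \<partial>lborel) =
          (\<integral>\<^sup>+s. ennreal (t ^ (p - 1)) * (ennreal (s ^ (p + q - 1)) * indicator {0..R / sqrt (1 + t\<^sup>2)} s) \<partial>lborel)"
        using True pos
        by (intro nn_integral_cong) (auto simp: indicator_def pos_le_divide_eq ennreal_mult)
      also have "\<dots> = ennreal (t ^ (p - 1)) * ennreal ((R / sqrt (1 + t\<^sup>2)) ^ (p + q) / real (p + q))"
        using p q R pos nn_integral_power_Icc[of "p + q" "R / sqrt (1 + t\<^sup>2)"]
        by (subst nn_integral_cmult) simp_all
      also have "(R / sqrt (1 + t\<^sup>2)) ^ (p + q) = R ^ (p + q) / (1 + t\<^sup>2) powr (real (p + q) / 2)"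
        using pos by (simp add: power_divide powr_half_sqrt[symmetric] powr_powr powr_realpow[symmetric] add_pos_nonneg)
      finally show ?thesis
        using True R by (simp add: mult_ac flip: ennreal_mult')
    qed auto
  qed
  \<comment> \<open>Closing the interval at \<open>\<epsilon>\<close> changes it by a null set.\<close>
  also have "\<dots> = (\<integral>\<^sup>+t. ennreal (R ^ (p + q) / real (p + q) * ?h t) * indicator {0..\<epsilon>} t \<partial>lborel)"
    by (intro nn_integral_cong_AE AE_I[of _ _ "{\<epsilon>}"]) (auto simp: indicator_def)
  also have "\<dots> = ennreal (R ^ (p + q) / real (p + q) * integral {0..\<epsilon>} ?h)"
  proof (rule nn_integral_has_integral_lebesgue')
    have "continuous_on {0..\<epsilon>} ?h"
      by (intro continuous_intros) (auto simp: add_pos_nonneg add_nonneg_eq_0_iff)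
    then show "((\<lambda>t. R ^ (p + q) / real (p + q) * ?h t) has_integral
        R ^ (p + q) / real (p + q) * integral {0..\<epsilon>} ?h) {0..\<epsilon>}"
      by (intro has_integral_mult_right integrable_integral integrable_continuous_real)
  qed (use R in auto)
  finally show ?thesis .
qed

text \<open>
  The Gamma factors in \<open>psi\<close> are exactly the ratio of sphere areas that polar coordinates produce:
  the powers of \<open>pi\<close> cancel.
\<close>

lemma psi_unit_ball_vol:
  assumes "0 < p" "0 < q"
  shows "psi p (p + q) \<epsilon> * unit_ball_vol (p + q) =
    real p * unit_ball_vol p * (real q * unit_ball_vol q) / real (p + q) *
      integral {0..\<epsilon>} (\<lambda>t. t ^ (p - 1) / (1 + t\<^sup>2) powr (real (p + q) / 2))"
proof -
  \<comment> \<open>\<open>k * unit_ball_vol k\<close> is the surface area of the unit sphere in dimension \<open>k\<close>.\<close>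
  have surface: "real k * unit_ball_vol k = 2 * pi powr (real k / 2) / Gamma (real k / 2)" if "0 < k" for k :: nat
  proof -
    have G: "Gamma (real k / 2 + 1) = real k / 2 * Gamma (real k / 2)"
      using that nonpos_Ints_nonpos[of "real k / 2"] by (intro Gamma_plus1) auto
    show ?thesis using that unfolding unit_ball_vol_def G by (simp add: field_simps)
  qed
  have "unit_ball_vol (p + q) = real (p + q) * unit_ball_vol (p + q) / real (p + q)"
    using assms by simp
  also have "\<dots> = 2 * pi powr (real (p + q) / 2) / Gamma (real (p + q) / 2) / real (p + q)"
    using assms by (subst surface) simp_all
  finally have "unit_ball_vol (p + q) = 2 * pi powr (real (p + q) / 2) / Gamma (real (p + q) / 2) / real (p + q)" .
  moreover have "Gamma (real p / 2 + real q / 2) \<noteq> 0"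
    using assms by (intro less_imp_neq[symmetric] Gamma_real_pos) simp
  ultimately show ?thesis
    using assms unfolding psi_def surface[OF assms(1)] surface[OF assms(2)]
    by (simp add: powr_add add_divide_distrib mult_ac)
qed

text \<open>
  Fubini splits the coordinates into \<open>S\<close> and its complement; each block contributes through its
  radius only, which reduces the claim to the planar integral.
\<close>

lemma emeasure_coordinate_cone:
  fixes S :: "'a::euclidean_space set"
  assumes S: "S \<subset> Basis" "S \<noteq> {}" and \<epsilon>: "0 \<le> \<epsilon>" and R: "0 \<le> R"
  shows "emeasure lborel {x. sqrt (\<Sum>b\<in>S. (x \<bullet> b)\<^sup>2) < \<epsilon> * sqrt (\<Sum>b\<in>Basis - S. (x \<bullet> b)\<^sup>2) \<and> norm x \<le> R}
    = ennreal (psi (card S) DIM('a) \<epsilon> * (unit_ball_vol DIM('a) * R ^ DIM('a)))"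
    (is "emeasure lborel ?X = _")
proof -
  interpret product_sigma_finite "\<lambda>_::'a. lborel :: real measure" by standard
  define S' where "S' = Basis - S"
  have fin: "finite S" "finite S'" using S finite_subset[of S Basis] by (auto simp: S'_def)
  have ne: "S \<noteq> {}" "S' \<noteq> {}" using S by (auto simp: S'_def)
  have disj: "S' \<inter> S = {}" and un: "S' \<union> S = Basis" using S by (auto simp: S'_def)
  have card: "DIM('a) = card S + card S'"
    using fin disj by (simp flip: un add: card_Un_disjoint)
  have pos: "0 < card S" "0 < card S'" using fin ne by (auto simp: card_gt_0_iff)
  let ?N = "\<lambda>K f. sqrt (\<Sum>b\<in>K. (f b :: real)\<^sup>2)"
  let ?c = "\<lambda>K::'a set. real (card K) * unit_ball_vol (card K)"
  let ?ind = "\<lambda>s r. if r < \<epsilon> * s \<and> r\<^sup>2 + s\<^sup>2 \<le> R\<^sup>2 then 1 else 0 :: ennreal"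
  have meas: "?N K \<in> borel_measurable (\<Pi>\<^sub>M b\<in>Basis. lborel)" if "K \<subseteq> Basis" for K
  proof (intro measurable_compose[OF _ borel_measurable_sqrt] borel_measurable_sum borel_measurable_power)
    fix b assume "b \<in> K"
    then show "(\<lambda>f. f b) \<in> borel_measurable (\<Pi>\<^sub>M b\<in>Basis. lborel)"
      using that measurable_component_singleton[of b Basis "\<lambda>_. lborel :: real measure"] by auto
  qed
  have [measurable]: "?N S \<in> borel_measurable (\<Pi>\<^sub>M b\<in>Basis. lborel)"
      "?N S' \<in> borel_measurable (\<Pi>\<^sub>M b\<in>Basis. lborel)"
    using S by (auto intro!: meas simp: S'_def)
  have nrm: "norm x \<le> R \<longleftrightarrow> (?N S (\<lambda>b. x \<bullet> b))\<^sup>2 + (?N S' (\<lambda>b. x \<bullet> b))\<^sup>2 \<le> R\<^sup>2" for x :: 'a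
  proof -
    have "(norm x)\<^sup>2 = (\<Sum>b\<in>S. (x \<bullet> b)\<^sup>2) + (\<Sum>b\<in>S'. (x \<bullet> b)\<^sup>2)"
      using fin disj unfolding power2_norm_eq_inner euclidean_inner[of x x] un[symmetric]
      by (subst sum.union_disjoint) (simp_all add: power2_eq_square)
    moreover have "norm x \<le> R \<longleftrightarrow> (norm x)\<^sup>2 \<le> R\<^sup>2"
      using R by (simp add: power2_le_iff_abs_le)
    ultimately show ?thesis by (simp add: sum_nonneg)
  qed
  have "?X \<in> sets borel" by measurable
  then have "emeasure lborel ?X = (\<integral>\<^sup>+x. ?ind (?N S' (\<lambda>b. x \<bullet> b)) (?N S (\<lambda>b. x \<bullet> b)) \<partial>lborel)"
    by (subst nn_integral_indicator[symmetric], simp, intro nn_integral_cong)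
      (simp add: indicator_def nrm S'_def)
  also have "\<dots> = (\<integral>\<^sup>+f. ?ind (?N S' f) (?N S f) \<partial>(\<Pi>\<^sub>M b\<in>Basis. lborel))"
  proof -
    have "?N S (\<lambda>b. (\<Sum>i\<in>Basis. f i *\<^sub>R i) \<bullet> b) = ?N S f" "?N S' (\<lambda>b. (\<Sum>i\<in>Basis. f i *\<^sub>R i) \<bullet> b) = ?N S' f" for f
      using S by (auto intro!: arg_cong[where f = sqrt] sum.cong simp: inner_sum_left_Basis S'_def)
    then show ?thesis
      by (subst lborel_eq) (simp add: nn_integral_distr)
  qed
  \<comment> \<open>The coordinates outside \<open>S\<close> form the outer integral, since the bound on \<open>r\<close> depends on \<open>s\<close>.\<close>
  also have "\<dots> = (\<integral>\<^sup>+y. (\<integral>\<^sup>+x. ?ind (?N S' y) (?N S x) \<partial>(\<Pi>\<^sub>M b\<in>S. lborel)) \<partial>(\<Pi>\<^sub>M b\<in>S'. lborel))"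
  proof -
    have "?N S (merge S' S (y, x)) = ?N S x" "?N S' (merge S' S (y, x)) = ?N S' y" for x y
      using disj by (auto intro!: arg_cong[where f = sqrt] sum.cong simp: merge_def)
    then show ?thesis
      using product_nn_integral_fold[OF disj fin(2,1), of "\<lambda>f. ?ind (?N S' f) (?N S f)"] by (simp add: un)
  qed
  also have "\<dots> = (\<integral>\<^sup>+y. (\<integral>\<^sup>+r. ennreal (?c S * r ^ (card S - 1)) * indicator {0..} r * ?ind (?N S' y) r \<partial>lborel)
      \<partial>(\<Pi>\<^sub>M b\<in>S'. lborel))"
    by (intro nn_integral_cong nn_integral_radial_PiM_lborel fin ne) measurable
  also have "\<dots> = (\<integral>\<^sup>+s. ennreal (?c S' * s ^ (card S' - 1)) * indicator {0..} s *
      (\<integral>\<^sup>+r. ennreal (?c S * r ^ (card S - 1)) * indicator {0..} r * ?ind s r \<partial>lborel) \<partial>lborel)"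
    by (rule nn_integral_radial_PiM_lborel[OF fin(2) ne(2)]) measurable
  also have "\<dots> = (\<integral>\<^sup>+s. (\<integral>\<^sup>+r. ennreal (?c S * ?c S') * (if 0 \<le> s \<and> 0 \<le> r \<and> r < \<epsilon> * s \<and> r\<^sup>2 + s\<^sup>2 \<le> R\<^sup>2
              then ennreal (r ^ (card S - 1) * s ^ (card S' - 1)) else 0) \<partial>lborel) \<partial>lborel)"
    by (subst nn_integral_cmult[symmetric], measurable)
      (auto intro!: nn_integral_cong simp: indicator_def mult_ac simp flip: ennreal_mult')
  also have "\<dots> = ennreal (?c S * ?c S') * (\<integral>\<^sup>+s. (\<integral>\<^sup>+r. (if 0 \<le> s \<and> 0 \<le> r \<and> r < \<epsilon> * s \<and> r\<^sup>2 + s\<^sup>2 \<le> R\<^sup>2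
              then ennreal (r ^ (card S - 1) * s ^ (card S' - 1)) else 0) \<partial>lborel) \<partial>lborel)"
    by (simp add: nn_integral_cmult)
  also have "\<dots> = ennreal (?c S * ?c S' * (R ^ (card S + card S') / real (card S + card S') *
      integral {0..\<epsilon>} (\<lambda>t. t ^ (card S - 1) / (1 + t\<^sup>2) powr (real (card S + card S') / 2))))"
    unfolding nn_integral_planar_sector[OF pos \<epsilon> R] by (rule ennreal_mult'[symmetric]) simp
  also have "?c S * ?c S' * (R ^ (card S + card S') / real (card S + card S') *
      integral {0..\<epsilon>} (\<lambda>t. t ^ (card S - 1) / (1 + t\<^sup>2) powr (real (card S + card S') / 2))) =
      psi (card S) DIM('a) \<epsilon> * (unit_ball_vol DIM('a) * R ^ DIM('a))"
    using psi_unit_ball_vol[OF pos, of \<epsilon>] unfolding card by (simp add: mult_ac)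
  finally show ?thesis .
qed

section \<open>The volume of a cone around an arbitrary subspace\<close>

text \<open>
  Gram-Schmidt extends \<open>B\<close> by nonzero vectors; normalizing all vectors leaves those of \<open>B\<close> fixed.
\<close>

lemma orthonormal_set_extends_to_basis:
  fixes B :: "'a::euclidean_space set"
  assumes orth: "pairwise orthogonal B" and unit: "\<And>b. b \<in> B \<Longrightarrow> norm b = 1"
  obtains D where "B \<subseteq> D" "pairwise orthogonal D" "\<And>d. d \<in> D \<Longrightarrow> norm d = 1"
    "finite D" "card D = DIM('a)" "span D = UNIV"
proof -
  obtain U where U: "U \<inter> insert 0 B = {}" "pairwise orthogonal (B \<union> U)" "span (B \<union> U) = span (B \<union> Basis)"
    using orthogonal_extension_strong[OF orth, of Basis] by metis
  have "span (B \<union> U) = UNIV"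
    unfolding U(3) by (metis span_Basis span_mono sup_ge2 top.extremum_uniqueI)
  define D where "D = B \<union> sgn ` U"
  have 1: "B \<subseteq> D" by (simp add: D_def)
  have 2: "norm d = 1" if "d \<in> D" for d
    using that unit U(1) by (auto simp: D_def norm_sgn)
  have sgn: "sgn b = b" if "b \<in> B" for b using unit[OF that] by (simp add: sgn_div_norm)
  then have D: "D = sgn ` (B \<union> U)" by (auto simp: D_def image_Un)
  have 3: "pairwise orthogonal D"
    unfolding D
  proof (rule pairwiseI, clarify)
    fix x y assume "x \<in> B \<union> U" "y \<in> B \<union> U" "sgn x \<noteq> sgn y"
    then have "orthogonal x y" using U(2) by (metis pairwise_def)
    then show "orthogonal (sgn x) (sgn y)" by (simp add: sgn_div_norm orthogonal_def)
  qed
  have "B \<union> U \<subseteq> span D"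
  proof
    fix x assume x: "x \<in> B \<union> U"
    have "x = norm x *\<^sub>R sgn x" by (cases "x = 0") (simp_all add: sgn_div_norm)
    moreover have "sgn x \<in> span D" using x by (auto simp: D intro: span_base)
    ultimately show "x \<in> span D" by (metis span_scale)
  qed
  then have 4: "span D = UNIV"
    using \<open>span (B \<union> U) = UNIV\<close> by (metis span_minimal subspace_span top.extremum_uniqueI)
  have "independent D"
    using 2 by (intro pairwise_orthogonal_independent[OF 3]) force
  then have "card D = DIM('a)" "finite D"
    using dim_eq_card[of D UNIV] 4 by (auto simp: independent_imp_finite)
  then show ?thesis using that 1 2 3 4 by blast
qed

text \<open>
  Matching an orthonormal basis that extends \<open>B\<close> with the standard basis defines a rotation
  that moves the span of \<open>B\<close> to a coordinate subspace.
\<close>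

lemma orthogonal_transformation_to_coordinates:
  fixes B :: "'a::euclidean_space set"
  assumes orth: "pairwise orthogonal B" and unit: "\<And>b. b \<in> B \<Longrightarrow> norm b = 1"
  obtains T :: "'a \<Rightarrow> 'a" and S :: "'a set" where "orthogonal_transformation T" "S \<subseteq> Basis" "card S = card B"
    "\<And>x. (\<Sum>b\<in>S. (T x \<bullet> b)\<^sup>2) = (\<Sum>b\<in>B. (x \<bullet> b)\<^sup>2)"
proof -
  obtain D where D: "B \<subseteq> D" "pairwise orthogonal D" "\<And>d. d \<in> D \<Longrightarrow> norm d = 1"
    "finite D" "card D = DIM('a)" "span D = UNIV"
    using orthonormal_set_extends_to_basis[OF orth unit] by metis
  obtain h where h: "bij_betw h D (Basis :: 'a set)"
    using finite_same_card_bij[of D "Basis :: 'a set"] D by auto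
  define S where "S = h ` B"
  define T where "T x = (\<Sum>d\<in>D. (x \<bullet> d) *\<^sub>R h d)" for x
  have hB: "bij_betw h B S" using h D(1) by (auto simp: S_def bij_betw_def inj_on_subset)
  have S: "S \<subseteq> Basis" using h D(1) by (auto simp: S_def bij_betw_def)
  have coord: "T x \<bullet> h d = x \<bullet> d" if "d \<in> D" for x d
  proof -
    have "T x \<bullet> h d = (\<Sum>e\<in>D. if e = d then x \<bullet> d else 0)"
      unfolding T_def inner_sum_left
    proof (rule sum.cong)
      fix e assume "e \<in> D"
      then have "h e \<in> Basis" "h d \<in> Basis" "h e = h d \<longleftrightarrow> e = d"
        using h that by (auto simp: bij_betw_def inj_on_eq_iff)
      then show "(x \<bullet> e) *\<^sub>R h e \<bullet> h d = (if e = d then x \<bullet> d else 0)"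
        by (simp add: inner_Basis)
    qed simp
    then show ?thesis using that D(4) by simp
  qed
  have "norm (T x) = norm x" for x
  proof -
    have "T x \<bullet> T x = (\<Sum>b\<in>Basis. (T x \<bullet> b) * (T x \<bullet> b))" by (rule euclidean_inner)
    also have "\<dots> = (\<Sum>d\<in>D. (T x \<bullet> h d) * (T x \<bullet> h d))"
      by (rule sum.reindex_bij_betw[OF h, symmetric])
    also have "\<dots> = (\<Sum>d\<in>D. (x \<bullet> d) *\<^sub>R d) \<bullet> x"
      by (simp add: coord inner_sum_left inner_commute[of x])
    also have "(\<Sum>d\<in>D. (x \<bullet> d) *\<^sub>R d) = x"
      by (rule orthonormal_basis_expand) (use D in auto)
    finally show ?thesis by (simp add: norm_eq_sqrt_inner)
  qed
  moreover have "linear T"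
    unfolding T_def by (intro linear_compose_sum ballI linearI) (simp_all add: inner_add_left scaleR_add_left)
  ultimately have "orthogonal_transformation T" by (simp add: orthogonal_transformation)
  moreover have "(\<Sum>b\<in>S. (T x \<bullet> b)\<^sup>2) = (\<Sum>b\<in>B. (x \<bullet> b)\<^sup>2)" for x
    using D(1) coord by (subst sum.reindex_bij_betw[OF hB, symmetric]) (auto intro!: sum.cong)
  moreover have "card S = card B" using hB by (simp add: bij_betw_same_card)
  ultimately show ?thesis using that S by blast
qed

text \<open>
  With \<open>a\<close> and \<open>b\<close> the squared lengths of two orthogonal components of a vector, this converts
  a bound \<open>c\<close> on the sine of the angle to the second component into a bound on its tangent. This
  is the origin of the argument \<open>c / sqrt (1 - c\<^sup>2)\<close> of \<open>psi\<close>.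
\<close>

lemma sqrt_less_mult_sqrt_add_iff:
  fixes a b c :: real
  assumes "0 \<le> a" "0 \<le> b" "0 \<le> c" "c < 1"
  shows "sqrt a < c * sqrt (a + b) \<longleftrightarrow> sqrt a < c / sqrt (1 - c\<^sup>2) * sqrt b"
proof -
  have "0 < 1 - c\<^sup>2" using assms by (simp add: power_less_one_iff abs_square_less_1)
  have less: "sqrt a < u \<longleftrightarrow> a < u\<^sup>2" if "0 \<le> u" for u
    using that assms by (metis real_sqrt_less_iff real_sqrt_unique)
  have "sqrt a < c * sqrt (a + b) \<longleftrightarrow> a < c\<^sup>2 * (a + b)"
    using assms by (subst less) (simp_all add: power_mult_distrib)
  also have "\<dots> \<longleftrightarrow> a * (1 - c\<^sup>2) < c\<^sup>2 * b"
    by (simp add: algebra_simps)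
  also have "\<dots> \<longleftrightarrow> a < c\<^sup>2 / (1 - c\<^sup>2) * b"
    using \<open>0 < 1 - c\<^sup>2\<close> by (simp add: pos_less_divide_eq)
  also have "\<dots> \<longleftrightarrow> sqrt a < c / sqrt (1 - c\<^sup>2) * sqrt b"
    using assms \<open>0 < 1 - c\<^sup>2\<close> by (subst less) (simp_all add: power_mult_distrib power_divide)
  finally show ?thesis .
qed

lemma emeasure_orthonormal_cone:
  fixes B :: "'a::euclidean_space set"
  assumes orth: "pairwise orthogonal B" and unit: "\<And>b. b \<in> B \<Longrightarrow> norm b = 1"
    and card: "0 < card B" "card B < DIM('a)" and c: "0 \<le> c" "c < 1" and R: "0 \<le> R"
  shows "emeasure lborel {x. sqrt (\<Sum>b\<in>B. (x \<bullet> b)\<^sup>2) < c * norm x \<and> norm x \<le> R}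
    = ennreal (psi (card B) DIM('a) (c / sqrt (1 - c\<^sup>2)) * (unit_ball_vol DIM('a) * R ^ DIM('a)))"
    (is "emeasure lborel ?X = _")
proof -
  obtain T :: "'a \<Rightarrow> 'a" and S :: "'a set" where T: "orthogonal_transformation T" and S: "S \<subseteq> Basis" "card S = card B"
    and TS: "\<And>x. (\<Sum>b\<in>S. (T x \<bullet> b)\<^sup>2) = (\<Sum>b\<in>B. (x \<bullet> b)\<^sup>2)"
    using orthogonal_transformation_to_coordinates[OF orth unit] by metis
  define \<epsilon> where "\<epsilon> = c / sqrt (1 - c\<^sup>2)"
  have "\<epsilon> \<ge> 0" using c by (simp add: \<epsilon>_def power_le_one)
  let ?Y = "{x. sqrt (\<Sum>b\<in>S. (x \<bullet> b)\<^sup>2) < \<epsilon> * sqrt (\<Sum>b\<in>Basis - S. (x \<bullet> b)\<^sup>2) \<and> norm x \<le> R}"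
  have split: "norm x = sqrt ((\<Sum>b\<in>S. (x \<bullet> b)\<^sup>2) + (\<Sum>b\<in>Basis - S. (x \<bullet> b)\<^sup>2))" for x :: 'a
    using sum.subset_diff[OF S(1) finite_Basis, of "\<lambda>b. (x \<bullet> b)\<^sup>2"]
    by (simp add: norm_eq_sqrt_inner euclidean_inner[of x x] power2_eq_square add.commute)
  have Y: "?Y = {x. sqrt (\<Sum>b\<in>S. (x \<bullet> b)\<^sup>2) < c * norm x \<and> norm x \<le> R}"
    unfolding split \<epsilon>_def using c by (subst sqrt_less_mult_sqrt_add_iff) (simp_all add: sum_nonneg)
  have X: "?X = T -` ?Y"
    unfolding Y using orthogonal_transformation_norm[OF T] by (auto simp: TS)
  have [measurable]: "?Y \<in> sets borel" by measurable
  have [measurable]: "T \<in> borel_measurable borel"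
    using orthogonal_transformation_linear[OF T]
    by (intro borel_measurable_continuous_onI linear_continuous_on)
      (simp add: linear_conv_bounded_linear)
  have "emeasure lborel ?X = emeasure (distr lborel borel T) ?Y"
    unfolding X by (subst emeasure_distr) simp_all
  also have "\<dots> = emeasure lborel ?Y"
    by (simp add: lborel_distr_orthogonal_transformation[OF T])
  also have "\<dots> = ennreal (psi (card S) DIM('a) \<epsilon> * (unit_ball_vol DIM('a) * R ^ DIM('a)))"
    using S card by (intro emeasure_coordinate_cone \<open>\<epsilon> \<ge> 0\<close> R) auto
  finally show ?thesis by (simp add: S(2) \<epsilon>_def)
qed

lemma psi_nonneg:
  assumes "0 < p" "p < n" "0 \<le> \<epsilon>"
  shows "0 \<le> psi p n \<epsilon>"
proof -
  have "(\<lambda>t. t ^ (p - 1) / (1 + t\<^sup>2) powr (real n / 2)) integrable_on {0..\<epsilon>}"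
    by (intro integrable_continuous_real continuous_intros) (auto simp: add_nonneg_eq_0_iff)
  then have "0 \<le> integral {0..\<epsilon>} (\<lambda>t. t ^ (p - 1) / (1 + t\<^sup>2) powr (real n / 2))"
    by (rule integral_nonneg) simp
  moreover have "0 < Gamma (real n / 2)" "0 < Gamma (real p / 2)" "0 < Gamma ((real n - real p) / 2)"
    using assms by (auto intro!: Gamma_real_pos)
  ultimately show ?thesis
    unfolding psi_def by (intro mult_nonneg_nonneg divide_nonneg_pos mult_pos_pos) simp_all
qed

text \<open>
  The exact volume behind all three claims: \<open>sqrt (\<Sum>b\<in>B. (x \<bullet> b)\<^sup>2)\<close> is the length of
  the orthogonal projection of \<open>x\<close> to the span of \<open>B\<close>.
\<close>

lemma measure_orthonormal_cone_ratio:
  fixes B :: "'a::euclidean_space set"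
  assumes orth: "pairwise orthogonal B" and unit: "\<And>b. b \<in> B \<Longrightarrow> norm b = 1"
    and card: "0 < card B" "card B < DIM('a)" and c: "0 \<le> c" "c < 1" and R: "0 < R"
  shows "measure lebesgue {x. sqrt (\<Sum>b\<in>B. (x \<bullet> b)\<^sup>2) < c * norm x \<and> norm x \<le> R} /
      measure lebesgue {x::'a. norm x \<le> R} = psi (card B) DIM('a) (c / sqrt (1 - c\<^sup>2))"
proof -
  let ?X = "{x. sqrt (\<Sum>b\<in>B. (x \<bullet> b)\<^sup>2) < c * norm x \<and> norm x \<le> R}"
  have "c\<^sup>2 \<le> 1" using c by (simp add: power_le_one)
  then have "0 \<le> psi (card B) DIM('a) (c / sqrt (1 - c\<^sup>2))"
    using card c by (intro psi_nonneg) simp_all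
  moreover have "?X \<in> sets borel" by measurable
  ultimately have "measure lebesgue ?X =
      psi (card B) DIM('a) (c / sqrt (1 - c\<^sup>2)) * (unit_ball_vol DIM('a) * R ^ DIM('a))"
    using R unfolding measure_completion[OF \<open>?X \<in> sets borel\<close>[folded sets_lborel]]
    by (simp add: measure_def emeasure_orthonormal_cone[OF orth unit card c])
  moreover have "{x::'a. norm x \<le> R} = cball 0 R" by auto
  moreover have "unit_ball_vol DIM('a) \<noteq> 0"
    by (metis less_irrefl of_nat_0_le_iff unit_ball_vol_pos)
  ultimately show ?thesis using R by (simp add: content_cball)
qed

section \<open>Extreme eigenvalues of self-adjoint maps\<close>

text \<open>
  The form attains its minimum \<open>0\<close> at \<open>v\<close>, so its derivative there vanishes in every direction.
  It suffices to test the direction \<open>g v\<close>, along which the form is a quadratic polynomial with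
  linear coefficient \<open>2 * (g v \<bullet> g v)\<close>.
\<close>

lemma semidefinite_form_zero_imp_kernel:
  fixes g :: "'a::real_inner \<Rightarrow> 'a"
  assumes lin: "linear g" and adj: "\<And>x y. x \<bullet> g y = g x \<bullet> y"
    and psd: "\<And>x. 0 \<le> x \<bullet> g x" and zero: "v \<bullet> g v = 0"
  shows "g v = 0"
proof (rule ccontr)
  assume "g v \<noteq> 0"
  define a where "a = g v \<bullet> g v"
  define c where "c = g v \<bullet> g (g v)"
  have a: "0 < a" using \<open>g v \<noteq> 0\<close> by (simp add: a_def)
  have c: "0 \<le> c" using psd by (simp add: c_def)
  have expand: "(v + t *\<^sub>R g v) \<bullet> g (v + t *\<^sub>R g v) = 2 * t * a + t\<^sup>2 * c" for t
    using zero adj[of v "g v"]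
    by (simp add: linear_add[OF lin] linear_scale[OF lin] inner_add_left inner_add_right a_def c_def
        power2_eq_square algebra_simps)
  \<comment> \<open>The linear term wins for small negative \<open>t\<close>; the choice \<open>t = - a / (c + 1)\<close> is also safe when \<open>c = 0\<close>.\<close>
  have "2 * (- a / (c + 1)) * a + (- a / (c + 1))\<^sup>2 * c = - (a\<^sup>2 * (c + 2) / (c + 1)\<^sup>2)"
    using c by (simp add: divide_simps power2_eq_square) (simp add: algebra_simps)
  moreover have "a\<^sup>2 * (c + 2) / (c + 1)\<^sup>2 > 0" using a c by simp
  ultimately show False
    using psd[of "v + (- a / (c + 1)) *\<^sub>R g v"] unfolding expand by linarith
qed

text \<open>
  The largest value \<open>l\<close> of the form on the compact unit sphere is attained at some \<open>v\<close>; then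
  \<open>l *\<^sub>R x - g x\<close> defines a semidefinite form that vanishes at \<open>v\<close>, so \<open>v\<close> is an
  eigenvector.
\<close>

lemma self_adjoint_max_eigenvalue:
  fixes g :: "'a::euclidean_space \<Rightarrow> 'a"
  assumes lin: "linear g" and adj: "\<And>x y. x \<bullet> g y = g x \<bullet> y"
  obtains l v where "v \<noteq> 0" "g v = l *\<^sub>R v" "\<And>w. w \<bullet> g w \<le> l * (w \<bullet> w)"
proof -
  have "continuous_on (sphere 0 1) (\<lambda>x. x \<bullet> g x)"
    using lin by (intro continuous_intros linear_continuous_on) (simp add: linear_conv_bounded_linear)
  moreover have "sphere 0 1 \<noteq> ({} :: 'a set)" by simp
  ultimately obtain v where v: "norm v = 1" and max: "\<And>w. norm w = 1 \<Longrightarrow> w \<bullet> g w \<le> v \<bullet> g v"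
    using continuous_attains_sup[OF compact_sphere, of 0 1 "\<lambda>x. x \<bullet> g x"] by (auto simp: dist_norm)
  define l where "l = v \<bullet> g v"
  have bound: "w \<bullet> g w \<le> l * (w \<bullet> w)" for w
  proof (cases "w = 0")
    case False
    have "w = norm w *\<^sub>R sgn w" using False by (simp add: sgn_div_norm)
    then have "w \<bullet> g w = (norm w)\<^sup>2 * (sgn w \<bullet> g (sgn w))"
      by (metis inner_scaleR_left inner_scaleR_right linear_scale[OF lin] mult.assoc power2_eq_square)
    also have "\<dots> \<le> (norm w)\<^sup>2 * l"
      using max[of "sgn w"] False by (intro mult_left_mono) (simp_all add: norm_sgn l_def)
    finally show ?thesis by (simp add: power2_norm_eq_inner mult.commute)
  qed (simp add: linear_0[OF lin])
  have "l *\<^sub>R v - g v = 0"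
  proof (rule semidefinite_form_zero_imp_kernel[of "\<lambda>x. l *\<^sub>R x - g x"])
    show "linear (\<lambda>x. l *\<^sub>R x - g x)"
      using lin by (intro linear_compose_sub linear_compose_scale_right linear_id[unfolded id_def])
    show "v \<bullet> (l *\<^sub>R v - g v) = 0"
      using v by (simp add: inner_diff_right l_def flip: power2_norm_eq_inner)
  qed (use adj bound in \<open>simp_all add: inner_diff_left inner_diff_right\<close>)
  moreover have "v \<noteq> 0" using v by auto
  ultimately show ?thesis using bound that[of v l] by simp
qed

text \<open>
  Eigenvectors of different eigenvalues are orthogonal, and an orthogonal family in a Euclidean
  space is finite.
\<close>

lemma self_adjoint_finite_eigenvalues:
  fixes g :: "'a::euclidean_space \<Rightarrow> 'a"
  assumes adj: "\<And>x y. x \<bullet> g y = g x \<bullet> y"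
  shows "finite {l. \<exists>v. v \<noteq> 0 \<and> g v = l *\<^sub>R v}" (is "finite ?L")
proof -
  define e where "e l = (SOME v. v \<noteq> 0 \<and> g v = l *\<^sub>R v)" for l
  have e: "e l \<noteq> 0" "g (e l) = l *\<^sub>R e l" if "l \<in> ?L" for l
    using that someI_ex[of "\<lambda>v. v \<noteq> 0 \<and> g v = l *\<^sub>R v"] by (auto simp: e_def)
  have orth: "e k \<bullet> e l = 0" if "k \<in> ?L" "l \<in> ?L" "k \<noteq> l" for k l
    using adj[of "e k" "e l"] that by (simp add: e)
  have "inj_on e ?L"
  proof (rule inj_onI, rule ccontr)
    fix k l assume "k \<in> ?L" "l \<in> ?L" "e k = e l" "k \<noteq> l"
    then show False using orth[of k l] e(1)[of l] by simp
  qed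
  moreover have "finite (e ` ?L)"
    by (rule pairwise_orthogonal_imp_finite) (auto simp: pairwise_def orthogonal_def intro!: orth)
  ultimately show ?thesis by (rule finite_imageD[rotated])
qed

section \<open>Extreme singular values\<close>

lemma inner_matrix_vector_transpose:
  fixes A :: "real^'n^'m"
  shows "(A *v x) \<bullet> y = x \<bullet> (transpose A *v y)"
  by (metis dot_lmul_matrix inner_commute transpose_matrix_vector)

lemma self_adjoint_gram:
  fixes A :: "real^'n^'m"
  shows "x \<bullet> ((A ** transpose A) *v y) = ((A ** transpose A) *v x) \<bullet> y"
    and "x \<bullet> ((A ** transpose A) *v x) = (norm (transpose A *v x))\<^sup>2"
proof -
  have *: "x \<bullet> ((A ** transpose A) *v y) = (transpose A *v x) \<bullet> (transpose A *v y)" for x y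
    unfolding matrix_vector_mul_assoc[symmetric]
    by (subst (1 2) inner_commute) (rule inner_matrix_vector_transpose)
  show "x \<bullet> ((A ** transpose A) *v y) = ((A ** transpose A) *v x) \<bullet> y"
    unfolding * by (subst (1 2) inner_commute) (simp only: *)
  show "x \<bullet> ((A ** transpose A) *v x) = (norm (transpose A *v x))\<^sup>2"
    unfolding * by (rule power2_norm_eq_inner[symmetric])
qed

text \<open>
  Without finiteness, \<open>Max\<close> and \<open>Min\<close> in the condition number would be unspecified.
\<close>

lemma finite_singular_values: "finite (singular_values A)"
proof (rule finite_subset)
  let ?L = "{l. \<exists>v. v \<noteq> 0 \<and> (A ** transpose A) *v v = l *\<^sub>R v}"
  show "singular_values A \<subseteq> sqrt ` ?L"
  proof
    fix \<sigma> assume "\<sigma> \<in> singular_values A"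
    then have "\<sigma> = sqrt (\<sigma>\<^sup>2)" "\<sigma>\<^sup>2 \<in> ?L" by (auto simp: singular_values_def)
    then show "\<sigma> \<in> sqrt ` ?L" by blast
  qed
  show "finite (sqrt ` ?L)"
    by (intro finite_imageI self_adjoint_finite_eigenvalues self_adjoint_gram)
qed

lemma singular_value_eigenvector:
  assumes "\<sigma> \<in> singular_values A"
  obtains v where "v \<noteq> 0" "0 \<le> \<sigma>" "A *v (transpose A *v v) = \<sigma>\<^sup>2 *\<^sub>R v" "norm (transpose A *v v) = \<sigma> * norm v"
proof -
  obtain v where v: "v \<noteq> 0" "0 \<le> \<sigma>" "(A ** transpose A) *v v = \<sigma>\<^sup>2 *\<^sub>R v"
    using assms by (auto simp: singular_values_def)
  then have "(norm (transpose A *v v))\<^sup>2 = (\<sigma> * norm v)\<^sup>2"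
    using self_adjoint_gram(2)[of v A] by (simp add: power_mult_distrib power2_norm_eq_inner)
  then have "norm (transpose A *v v) = \<sigma> * norm v"
    using v(2) by simp
  then show ?thesis using that v by (metis matrix_vector_mul_assoc)
qed

text \<open>
  The largest eigenvalue of the Gram matrix \<open>A ** transpose A\<close> has the largest singular value
  as its square root, and its extremal property bounds the transpose of \<open>A\<close>.
\<close>

lemma Max_singular_value:
  shows "Max (singular_values A) \<in> singular_values A"
    and "norm (transpose A *v w) \<le> Max (singular_values A) * norm w"
proof -
  obtain l v where v: "v \<noteq> 0" "(A ** transpose A) *v v = l *\<^sub>R v"
    and max: "\<And>w. w \<bullet> ((A ** transpose A) *v w) \<le> l * (w \<bullet> w)"
    using self_adjoint_max_eigenvalue[OF matrix_vector_mul_linear self_adjoint_gram(1)] by blast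
  have norm: "(norm (transpose A *v w))\<^sup>2 \<le> l * (norm w)\<^sup>2" for w
    using max[of w] by (simp add: self_adjoint_gram(2) power2_norm_eq_inner)
  have l: "0 \<le> l"
    using norm[of v] v(1) by (smt (verit) zero_le_power2 mult_neg_pos zero_less_norm_iff zero_less_power)
  have "sqrt l \<in> singular_values A" using v l by (auto simp: singular_values_def)
  moreover have "\<sigma> \<le> sqrt l" if \<sigma>: "\<sigma> \<in> singular_values A" for \<sigma>
  proof -
    obtain u where u: "u \<noteq> 0" "0 \<le> \<sigma>" "norm (transpose A *v u) = \<sigma> * norm u"
      using singular_value_eigenvector[OF \<sigma>] by metis
    then have "\<sigma>\<^sup>2 \<le> l" using norm[of u] by (simp add: power_mult_distrib)
    then show ?thesis by (rule real_le_rsqrt)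
  qed
  ultimately have Max: "Max (singular_values A) = sqrt l"
    by (intro Max_eqI finite_singular_values) auto
  show "Max (singular_values A) \<in> singular_values A" using Max \<open>sqrt l \<in> _\<close> by simp
  have "norm (transpose A *v w) \<le> sqrt (l * (norm w)\<^sup>2)"
    using norm by (rule real_le_rsqrt)
  then show "norm (transpose A *v w) \<le> Max (singular_values A) * norm w"
    by (simp add: Max real_sqrt_mult)
qed

text \<open>
  The smallest eigenvalue of the Gram matrix is found as minus the largest eigenvalue of its negative.
\<close>

lemma Min_singular_value:
  shows "Min (singular_values A) \<in> singular_values A"
    and "Min (singular_values A) * norm w \<le> norm (transpose A *v w)"
proof -
  have "linear (\<lambda>v. - ((A ** transpose A) *v v))"
    by (intro linear_compose_neg matrix_vector_mul_linear)
  then obtain k v where v: "v \<noteq> 0" "- ((A ** transpose A) *v v) = k *\<^sub>R v"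
    and max: "\<And>w. w \<bullet> (- ((A ** transpose A) *v w)) \<le> k * (w \<bullet> w)"
    by (rule self_adjoint_max_eigenvalue)
      (simp_all only: inner_minus_left inner_minus_right self_adjoint_gram(1))
  define l where "l = - k"
  have eig: "(A ** transpose A) *v v = l *\<^sub>R v" using v(2) by (simp add: l_def minus_equation_iff)
  have norm: "l * (norm w)\<^sup>2 \<le> (norm (transpose A *v w))\<^sup>2" for w
    using max[of w] by (simp add: self_adjoint_gram(2) power2_norm_eq_inner l_def)
  have "l * (norm v)\<^sup>2 = (norm (transpose A *v v))\<^sup>2"
    using self_adjoint_gram(2)[of v A] by (simp add: eig power2_norm_eq_inner)
  then have l: "0 \<le> l" using v(1)
    by (smt (verit) zero_le_power2 mult_neg_pos zero_less_norm_iff zero_less_power)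
  have "sqrt l \<in> singular_values A" using v(1) eig l by (auto simp: singular_values_def)
  moreover have "sqrt l \<le> \<sigma>" if \<sigma>: "\<sigma> \<in> singular_values A" for \<sigma>
  proof -
    obtain u where u: "u \<noteq> 0" "0 \<le> \<sigma>" "norm (transpose A *v u) = \<sigma> * norm u"
      using singular_value_eigenvector[OF \<sigma>] by metis
    then have "l \<le> \<sigma>\<^sup>2" using norm[of u] by (simp add: power_mult_distrib)
    then show ?thesis using u(2) by (rule real_le_lsqrt[rotated -1])
  qed
  ultimately have Min: "Min (singular_values A) = sqrt l"
    by (intro Min_eqI finite_singular_values) auto
  show "Min (singular_values A) \<in> singular_values A" using Min \<open>sqrt l \<in> _\<close> by simp
  have "sqrt (l * (norm w)\<^sup>2) \<le> norm (transpose A *v w)"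
    using norm[of w] by (simp add: real_le_lsqrt)
  then show "Min (singular_values A) * norm w \<le> norm (transpose A *v w)"
    by (simp add: Min real_sqrt_mult)
qed

text \<open>
  The bound for the transpose carries over to \<open>A\<close> by duality, through Cauchy-Schwarz.
\<close>

lemma norm_matrix_vector_le_Max_singular_value:
  fixes A :: "real^'n^'m"
  shows "norm (A *v x) \<le> Max (singular_values A) * norm x"
proof -
  have "(norm (A *v x))\<^sup>2 = x \<bullet> (transpose A *v (A *v x))"
    by (simp add: power2_norm_eq_inner inner_matrix_vector_transpose)
  also have "\<dots> \<le> norm x * norm (transpose A *v (A *v x))"
    by (rule norm_cauchy_schwarz)
  also have "\<dots> \<le> norm x * (Max (singular_values A) * norm (A *v x))"
    by (intro mult_left_mono Max_singular_value) simp
  finally have le: "norm (A *v x) * norm (A *v x) \<le> (Max (singular_values A) * norm x) * norm (A *v x)"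
    by (simp add: power2_eq_square mult_ac)
  show ?thesis
  proof (cases "norm (A *v x) = 0")
    case True
    have "0 \<le> Max (singular_values A)" using Max_singular_value(1)[of A] by (auto simp: singular_values_def)
    then show ?thesis unfolding True by simp
  qed (use le in \<open>simp add: mult_le_cancel_right\<close>)
qed

text \<open>
  The lower bound can only hold on the row space, where \<open>A\<close> has no kernel, so it is stated for
  vectors of the form \<open>transpose A *v v\<close>. It follows by duality, as the squared norm of such
  a vector is the inner product of \<open>v\<close> with its image under \<open>A\<close>.
\<close>

lemma Min_singular_value_le_norm_matrix_vector:
  fixes A :: "real^'n^'m"
  shows "Min (singular_values A) * norm (transpose A *v v) \<le> norm (A *v (transpose A *v v))"
proof (cases "norm (transpose A *v v) = 0")
  case False
  have nonneg: "0 \<le> Min (singular_values A)"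
    using Min_singular_value(1)[of A] by (auto simp: singular_values_def)
  have "Min (singular_values A) * (norm (transpose A *v v))\<^sup>2
      = Min (singular_values A) * ((A *v (transpose A *v v)) \<bullet> v)"
    by (simp add: power2_norm_eq_inner inner_matrix_vector_transpose)
  also have "\<dots> \<le> Min (singular_values A) * (norm (A *v (transpose A *v v)) * norm v)"
    by (intro mult_left_mono norm_cauchy_schwarz nonneg)
  also have "\<dots> = norm (A *v (transpose A *v v)) * (Min (singular_values A) * norm v)"
    by (simp add: mult_ac)
  also have "\<dots> \<le> norm (A *v (transpose A *v v)) * norm (transpose A *v v)"
    by (intro mult_left_mono Min_singular_value) simp
  finally show ?thesis
    using False by (simp add: power2_eq_square mult.assoc[symmetric] mult_le_cancel_right)
qed simp

text \<open>
  The bound on \<open>A *v x\<close> is attained at the image under the transpose of a top eigenvector of the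
  Gram matrix.
\<close>

lemma spectral_norm_eq_Max_singular_value: "spectral_norm A = Max (singular_values A)"
proof (rule antisym)
  show "spectral_norm A \<le> Max (singular_values A)"
    unfolding spectral_norm_def by (intro onorm_le norm_matrix_vector_le_Max_singular_value)
  obtain v where v: "v \<noteq> 0" "0 \<le> Max (singular_values A)"
    "A *v (transpose A *v v) = (Max (singular_values A))\<^sup>2 *\<^sub>R v"
    "norm (transpose A *v v) = Max (singular_values A) * norm v"
    using singular_value_eigenvector[OF Max_singular_value(1)[of A]] by metis
  have "norm (A *v (transpose A *v v)) \<le> spectral_norm A * norm (transpose A *v v)"
    unfolding spectral_norm_def by (intro onorm matrix_vector_mul_bounded_linear)
  then have le: "Max (singular_values A) * (Max (singular_values A) * norm v) \<le> spectral_norm A * (Max (singular_values A) * norm v)"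
    using v by (simp add: power2_eq_square mult.assoc)
  show "Max (singular_values A) \<le> spectral_norm A"
  proof (cases "Max (singular_values A) = 0")
    case True
    show ?thesis unfolding True spectral_norm_def by (intro onorm_pos_le matrix_vector_mul_bounded_linear)
  next
    case False
    then have "0 < Max (singular_values A) * norm v" using v by simp
    then show ?thesis using le by (simp only: mult_le_cancel_right_pos)
  qed
qed

lemma full_rank_transpose_inj:
  fixes A :: "real^'n^'m"
  assumes "rank A = CARD('m)"
  shows "inj ((*v) (transpose A))"
  using assms by (simp flip: full_rank_injective add: rank_transpose)

lemma Min_singular_value_pos:
  fixes A :: "real^'n^'m"
  assumes "rank A = CARD('m)"
  shows "0 < Min (singular_values A)"
proof -
  obtain v where v: "v \<noteq> 0" "0 \<le> Min (singular_values A)" "norm (transpose A *v v) = Min (singular_values A) * norm v"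
    using singular_value_eigenvector[OF Min_singular_value(1)[of A]] by metis
  have "transpose A *v v \<noteq> transpose A *v 0"
    using v(1) full_rank_transpose_inj[OF assms] by (metis injD)
  then have "norm (transpose A *v v) > 0" by simp
  then have "0 < Min (singular_values A) * norm v" by (simp only: v(3))
  then show ?thesis using v by (simp add: zero_less_mult_iff)
qed

text \<open>
  \<open>A\<close> vanishes on the orthogonal complement of its row space, so \<open>A *v x\<close> depends only on the
  projection of \<open>x\<close> to the row space, and on the row space the extreme singular values bound
  the distortion of \<open>A\<close>.
\<close>

lemma orthonormal_row_space_basis:
  fixes A :: "real^'n^'m"
  assumes "rank A = CARD('m)"
  obtains B :: "(real^'n) set" where "pairwise orthogonal B" "\<And>b. b \<in> B \<Longrightarrow> norm b = 1" "card B = CARD('m)"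
    "\<And>x. norm (A *v x) \<le> Max (singular_values A) * sqrt (\<Sum>b\<in>B. (x \<bullet> b)\<^sup>2)"
    "\<And>x. Min (singular_values A) * sqrt (\<Sum>b\<in>B. (x \<bullet> b)\<^sup>2) \<le> norm (A *v x)"
proof -
  let ?W = "range ((*v) (transpose A))"
  have "subspace ?W"
    by (intro linear_subspace_image matrix_vector_mul_linear subspace_UNIV)
  then obtain B where B: "B \<subseteq> ?W" "pairwise orthogonal B" "\<And>b. b \<in> B \<Longrightarrow> norm b = 1"
    "independent B" "card B = dim ?W" "span B = ?W"
    using orthonormal_basis_subspace by metis
  have fin: "finite B" using B(2) by (rule pairwise_orthogonal_imp_finite)
  have "dim ?W = dim (UNIV :: (real^'m) set)"
    using full_rank_transpose_inj[OF assms]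
    by (intro dim_image_eq matrix_vector_mul_linear) (simp only: span_UNIV)
  then have "dim ?W = CARD('m)" by simp
  \<comment> \<open>The orthogonal projection onto the row space.\<close>
  define P where "P x = (\<Sum>b\<in>B. (x \<bullet> b) *\<^sub>R b)" for x
  have Pb: "P x \<bullet> b = x \<bullet> b" if "b \<in> B" for x b
  proof -
    have "P x \<bullet> b = (\<Sum>e\<in>B. if e = b then x \<bullet> b else 0)"
      unfolding P_def inner_sum_left
    proof (rule sum.cong)
      fix e assume "e \<in> B"
      then show "(x \<bullet> e) *\<^sub>R e \<bullet> b = (if e = b then x \<bullet> b else 0)"
        using B(2,3) that by (auto simp: pairwise_def orthogonal_def norm_eq_1)
    qed simp
    then show ?thesis using that fin by simp
  qed
  have normP: "norm (P x) = sqrt (\<Sum>b\<in>B. (x \<bullet> b)\<^sup>2)" for x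
  proof -
    have "P x \<bullet> P x = (\<Sum>b\<in>B. (x \<bullet> b) * (P x \<bullet> b))"
      by (subst (2) P_def) (simp add: inner_sum_right)
    then show ?thesis by (simp add: norm_eq_sqrt_inner Pb power2_eq_square)
  qed
  have "P x \<in> span B" for x
    unfolding P_def by (intro span_sum span_scale span_base)
  then have PW: "\<exists>v. P x = transpose A *v v" for x unfolding B(6) by auto
  have AP: "A *v x = A *v P x" for x
  proof -
    have "(x - P x) \<bullet> w = 0" if "w \<in> ?W" for w
      using orthogonal_to_span[of w B "x - P x"] that unfolding B(6)[symmetric]
      by (simp add: orthogonal_def inner_diff_left Pb)
    then have "(A *v (x - P x)) \<bullet> (A *v (x - P x)) = 0"
      by (subst inner_matrix_vector_transpose) simp
    then show ?thesis by (simp add: matrix_vector_mult_diff_distrib)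
  qed
  show ?thesis
  proof (rule that[of B])
    show "norm (A *v x) \<le> Max (singular_values A) * sqrt (\<Sum>b\<in>B. (x \<bullet> b)\<^sup>2)" for x
      unfolding AP[of x] normP[symmetric] by (rule norm_matrix_vector_le_Max_singular_value)
    show "Min (singular_values A) * sqrt (\<Sum>b\<in>B. (x \<bullet> b)\<^sup>2) \<le> norm (A *v x)" for x
      using PW[of x] Min_singular_value_le_norm_matrix_vector[of A] unfolding AP[of x] normP[symmetric] by metis
  qed (use B \<open>dim ?W = CARD('m)\<close> in auto)
qed

section \<open>Inputs close to the kernel of a matrix\<close>

theorem theorem2p6:
  fixes A :: "real^'n^'m" and \<delta> :: real
  assumes "CARD('m) < CARD('n)"
    and "rank A = CARD('m)"
    and "0 \<le> \<delta>" and "\<delta> < 1"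
  shows "(cond_num A * \<delta> < 1 \<longrightarrow>
            (\<forall>R>0. vol_ratio A \<delta> R \<le>
               psi CARD('m) CARD('n) (cond_num A * \<delta> / sqrt (1 - (cond_num A)\<^sup>2 * \<delta>\<^sup>2)))) \<and>
         (\<forall>R>0. vol_ratio A \<delta> R \<ge> psi CARD('m) CARD('n) (\<delta> / sqrt (1 - \<delta>\<^sup>2))) \<and>
         (cond_num A = 1 \<longrightarrow>
            (\<forall>R>0. vol_ratio A \<delta> R =
                 psi CARD('m) CARD('n) (cond_num A * \<delta> / sqrt (1 - (cond_num A)\<^sup>2 * \<delta>\<^sup>2)) \<and>
               vol_ratio A \<delta> R = psi CARD('m) CARD('n) (\<delta> / sqrt (1 - \<delta>\<^sup>2))))"
proof -
  define \<sigma> where "\<sigma> = Max (singular_values A)"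
  define \<tau> where "\<tau> = Min (singular_values A)"
  obtain B :: "(real^'n) set" where B: "pairwise orthogonal B" "\<And>b. b \<in> B \<Longrightarrow> norm b = 1" "card B = CARD('m)"
    and upper: "\<And>x. norm (A *v x) \<le> \<sigma> * sqrt (\<Sum>b\<in>B. (x \<bullet> b)\<^sup>2)"
    and lower: "\<And>x. \<tau> * sqrt (\<Sum>b\<in>B. (x \<bullet> b)\<^sup>2) \<le> norm (A *v x)"
    using orthonormal_row_space_basis[OF assms(2)] unfolding \<sigma>_def \<tau>_def by metis
  have \<tau>: "0 < \<tau>" unfolding \<tau>_def by (rule Min_singular_value_pos[OF assms(2)])
  have "\<tau> \<le> \<sigma>"
    unfolding \<tau>_def \<sigma>_def by (rule Max_ge[OF finite_singular_values Min_singular_value(1)])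
  with \<tau> have \<sigma>: "0 < \<sigma>" by linarith
  have \<kappa>: "cond_num A = \<sigma> / \<tau>" by (simp add: cond_num_def \<sigma>_def \<tau>_def)
  let ?cone = "\<lambda>c R. {x. sqrt (\<Sum>b\<in>B. (x \<bullet> b)\<^sup>2) < c * norm x \<and> norm x \<le> R}"
  have ratio: "measure lebesgue (?cone c R) / measure lebesgue {x::real^'n. norm x \<le> R} =
      psi CARD('m) CARD('n) (c / sqrt (1 - c\<^sup>2))" if "0 \<le> c" "c < 1" "0 < R" for c R
    using measure_orthonormal_cone_ratio[OF B(1,2), of c R] that B(3) assms(1) by simp
  have [measurable]: "(\<lambda>x. A *v x) \<in> borel_measurable borel"
    by (intro borel_measurable_continuous_onI matrix_vector_mult_linear_continuous_on)
  have fmeas: "{x. norm x \<le> R \<and> Q x} \<in> fmeasurable lebesgue" if "{x. norm x \<le> R \<and> Q x} \<in> sets borel"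
    for R and Q :: "real^'n \<Rightarrow> bool"
    by (rule fmeasurableI2[of "cball 0 R"]) (use that in auto)
  have mono: "measure lebesgue {x. norm x \<le> R \<and> Q x} / measure lebesgue {x::real^'n. norm x \<le> R}
      \<le> measure lebesgue {x. norm x \<le> R \<and> Q' x} / measure lebesgue {x::real^'n. norm x \<le> R}"
    if "{x. norm x \<le> R \<and> Q x} \<in> sets borel" "{x. norm x \<le> R \<and> Q' x} \<in> sets borel" "\<And>x. Q x \<Longrightarrow> Q' x"
    for R and Q Q' :: "real^'n \<Rightarrow> bool"
    using that by (intro divide_right_mono measure_mono_fmeasurable fmeas) (auto dest: fmeas)
  have ge: "psi CARD('m) CARD('n) (\<delta> / sqrt (1 - \<delta>\<^sup>2)) \<le> vol_ratio A \<delta> R" if "0 < R" for R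
  proof -
    have "norm (A *v x) < \<delta> * spectral_norm A * norm x"
      if "sqrt (\<Sum>b\<in>B. (x \<bullet> b)\<^sup>2) < \<delta> * norm x" for x
    proof -
      have "norm (A *v x) \<le> \<sigma> * sqrt (\<Sum>b\<in>B. (x \<bullet> b)\<^sup>2)" by (rule upper)
      also have "\<dots> < \<sigma> * (\<delta> * norm x)" using that \<sigma> by (rule mult_strict_left_mono)
      finally show ?thesis by (simp add: spectral_norm_eq_Max_singular_value \<sigma>_def mult_ac)
    qed
    then show ?thesis
      unfolding ratio[OF assms(3,4) that, symmetric] vol_ratio_def conj_commute[of _ "norm _ \<le> R"]
      by (intro mono) measurable
  qed
  have le: "vol_ratio A \<delta> R \<le> psi CARD('m) CARD('n) (cond_num A * \<delta> / sqrt (1 - (cond_num A)\<^sup>2 * \<delta>\<^sup>2))"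
    if "cond_num A * \<delta> < 1" "0 < R" for R
  proof -
    have nonneg: "0 \<le> cond_num A * \<delta>" using \<tau> \<sigma> assms(3) by (simp add: \<kappa>)
    have "sqrt (\<Sum>b\<in>B. (x \<bullet> b)\<^sup>2) < cond_num A * \<delta> * norm x"
      if "norm (A *v x) < \<delta> * spectral_norm A * norm x" for x
    proof -
      have "\<tau> * sqrt (\<Sum>b\<in>B. (x \<bullet> b)\<^sup>2) < \<delta> * \<sigma> * norm x"
        using lower[of x] that by (simp add: spectral_norm_eq_Max_singular_value \<sigma>_def)
      then show ?thesis using \<tau> by (simp add: \<kappa> pos_less_divide_eq mult_ac)
    qed
    then show ?thesis
      unfolding power_mult_distrib[symmetric] ratio[OF nonneg that, symmetric] vol_ratio_def
        conj_commute[of _ "norm _ \<le> R"]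
      by (intro mono) measurable
  qed
  show ?thesis
    using ge le assms(4) by (auto intro!: antisym)
qed

end
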